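(* For any positive integers $n$ and $k$, if $n < k^2+2k+2$, then $\varPi(n;k)=\emptyset$.
   Context: All graphs are simple, finite and undirected. The detour order of a graph $G$ is the number of vertices of a longest path in $G$. A Hamilton path of a graph is a path through all of its vertices. For positive integers $n$ and $k$, $\varPi(n;k)$ denotes the set of graphs $G$ of order $n$ such that the detour order of $G$ equals $n-k$ and $G-S$ has a Hamilton path for every subset $S \subseteq V(G)$ with $|S|=k$.
   Formalization: The case n = k+1 is excluded: there the claim is false, since the edgeless graph on k+1 vertices has detour order 1 = n−k and deleting any k vertices leaves a single vertex, which has a Hamilton path. *)

theory Defs
  imports Graph_Theory.Graph_Theory
begin

text \<open>
  A simple finite undirected graph is a \<^locale>\<open>pair_graph\<close>: a finite vertex set together with a
  symmetric irreflexive edge relation. A path is a \<^const>\<open>vpath\<close>, i.e. a nonempty repetition-free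
  list of vertices, consecutive ones being adjacent; a single vertex is a path.
\<close>

text \<open>
  The set below is finite for a finite graph, and it is nonempty as soon as the graph has a vertex,
  so \<^const>\<open>Max\<close> is meaningful for all graphs of positive order.
\<close>

definition detour_order :: "('a, 'b) pre_digraph \<Rightarrow> nat" where
  "detour_order G = Max {length p | p. vpath p G}"

definition hamilton_path :: "'a list \<Rightarrow> ('a, 'b) pre_digraph \<Rightarrow> bool" where
  "hamilton_path p G \<longleftrightarrow> vpath p G \<and> set p = verts G"

text \<open>
  The detour order being \<open>n - k\<close> is written additively, to avoid truncated subtraction.
  The null graph has no Hamilton path here, but \<open>G - S\<close> is null only if \<open>n = k\<close>, where the
  condition on the detour order already fails for positive \<open>n\<close>.
\<close>

definition Pi_graphs :: "nat \<Rightarrow> nat \<Rightarrow> 'a pair_pre_digraph set" where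
  "Pi_graphs n k = {G. pair_graph G \<and> card (pverts G) = n \<and>
     detour_order (with_proj G) + k = n \<and>
     (\<forall>S \<subseteq> pverts G. card S = k \<longrightarrow>
        (\<exists>p. hamilton_path p (with_proj G \<restriction> (pverts G - S))))}"

text \<open>
  The edgeless graph on \<open>k + 1\<close> vertices belongs to \<open>\<Pi>(k + 1; k)\<close>: its longest paths are single
  vertices, and deleting \<open>k\<close> vertices leaves a single vertex. So \<open>\<Pi>(n; k)\<close> is not empty for
  \<open>n = k + 1\<close>.
\<close>

lemma edgeless_in_Pi_graphs:
  fixes V :: "'a set"
  assumes "card V = k + 1"
  shows "\<lparr>pverts = V, parcs = {}\<rparr> \<in> Pi_graphs (k + 1) k"
proof -
  let ?G = "\<lparr>pverts = V, parcs = {}\<rparr> :: 'a pair_pre_digraph"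
  have fin: "finite V" using assms by (metis add_is_0 card.infinite one_neq_zero)
  have "V \<noteq> {}" using assms by auto
  have graph: "pair_graph ?G"
    by unfold_locales (auto simp: fin symmetric_def sym_def)
  have len: "length p = 1" if "vpath p (with_proj ?G)" for p
    using that by (cases p rule: vwalk_arcs.cases) (auto simp: vpath_def vwalk_def)
  have single: "vpath [v] (with_proj ?G)" if "v \<in> V" for v
    using that by (auto simp: vpath_def vwalk_def)
  obtain v where "v \<in> V" using \<open>V \<noteq> {}\<close> by blast
  have "{length p | p. vpath p (with_proj ?G)} = {1}" (is "?L = _")
  proof
    show "?L \<subseteq> {1}" using len by blast
    have "length [v] \<in> ?L" using single[OF \<open>v \<in> V\<close>] by blast
    then show "{1} \<subseteq> ?L" by simp
  qed
  then have detour: "detour_order (with_proj ?G) = 1"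
    by (simp add: detour_order_def)
  have "\<exists>p. hamilton_path p (with_proj ?G \<restriction> (V - S))" if "S \<subseteq> V" "card S = k" for S
  proof -
    have "card (V - S) = 1"
      using that fin assms by (simp add: card_Diff_subset finite_subset)
    then obtain v where "V - S = {v}" by (auto simp: card_1_singleton_iff)
    then have "hamilton_path [v] (with_proj ?G \<restriction> (V - S))"
      by (auto simp: hamilton_path_def vpath_def vwalk_def)
    then show ?thesis by blast
  qed
  then show ?thesis
    using graph detour assms by (simp add: Pi_graphs_def)
qed

end

theory Submission
  imports Defs
begin

text \<open>
  Let \<open>m = n - k\<close> be the detour order, so that every Hamilton path of \<open>G - S\<close> with \<open>|S| = k\<close> is a
  longest path of \<open>G\<close>. Hence a path with \<open>c\<close> vertices inside \<open>S\<close> whose ends are adjacent to two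
  vertices of such a Hamilton path forces at least \<open>c\<close> vertices between these two. This exchange
  argument yields minimum degree at least \<open>k + 2\<close> and an induced path on \<open>k\<close> vertices. Delete the
  latter: at least \<open>k\<^sup>2\<close> edges lead from it to the Hamilton path of the rest, and if \<open>L i\<close> denotes the
  set of deleted vertices adjacent to the \<open>i\<close>-th vertex of that path, then consecutive attachments
  \<open>i < j\<close> satisfy \<open>2 (j - i) \<ge> |L i| + |L j| + 2\<close>, with a gap of at least \<open>(k + |L i|) / 2\<close> at both
  ends. Summing up, \<open>m \<ge> k + (k + 1) + k\<^sup>2\<close>.
\<close>

section \<open>Packing intervals and double counting\<close>

(* Around the point 2 * i one centres an interval of length 2 * card (L i) + 2. The spacing
   hypotheses make these intervals disjoint and keep them inside an interval of length 2 * m - 2 * k. *)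
lemma sum_card_labels_le:
  fixes L :: "nat \<Rightarrow> nat set" and k m :: nat
  assumes labels: "\<And>i. i < m \<Longrightarrow> L i \<subseteq> {..<k}"
    and gap: "\<And>i j a b. i < j \<Longrightarrow> j < m \<Longrightarrow> a \<in> L i \<Longrightarrow> b \<in> L j \<Longrightarrow>
      i + 2 + a \<le> j + b \<and> i + 2 + b \<le> j + a"
    and left: "\<And>i a. i < m \<Longrightarrow> a \<in> L i \<Longrightarrow> a + 1 \<le> i \<and> k \<le> i + a"
    and right: "\<And>i a. i < m \<Longrightarrow> a \<in> L i \<Longrightarrow> i + a + 2 \<le> m \<and> k + i + 1 \<le> m + a"
    and nonempty: "\<exists>i<m. L i \<noteq> {}"
  shows "k + card {i. i < m \<and> L i \<noteq> {}} + (\<Sum>i<m. card (L i)) \<le> m"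
proof -
  define I where "I = {i. i < m \<and> L i \<noteq> {}}"
  define J where "J i = {2 * int i - int (card (L i)) - 1 ..< 2 * int i + int (card (L i)) + 1}" for i
  have finI: "finite I" by (simp add: I_def)
  have finL: "finite (L i)" if "i \<in> I" for i
    using labels[of i] that finite_subset by (auto simp: I_def)
  have ext: "Min (L i) \<in> L i" "Max (L i) \<in> L i" if "i \<in> I" for i
    using finL[OF that] that by (auto simp: I_def)
  have width: "card (L i) + Min (L i) \<le> Max (L i) + 1" if "i \<in> I" for i
  proof -
    have "L i \<subseteq> {Min (L i)..Max (L i)}" using finL[OF that] by auto
    then have "card (L i) \<le> card {Min (L i)..Max (L i)}" by (intro card_mono) auto
    moreover have "Min (L i) \<le> Max (L i)" using finL[OF that] ext[OF that] by simp
    ultimately show ?thesis by simp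
  qed
  \<comment> \<open>Add the \<open>gap\<close> inequalities for (\<open>Min\<close>,
    \<open>Max\<close>) and for (\<open>Max\<close>, \<open>Min\<close>): the spreads of both label
    sets appear, and by \<open>width\<close> each is at least the cardinality minus one.\<close>
  have sep: "card (L i) + card (L j) + 2 * i + 2 \<le> 2 * j" if "i \<in> I" "j \<in> I" "i < j" for i j
  proof -
    have "j < m" using that by (simp add: I_def)
    show ?thesis
      using gap[OF \<open>i < j\<close> \<open>j < m\<close> ext(1)[OF that(1)] ext(2)[OF that(2)]]
        gap[OF \<open>i < j\<close> \<open>j < m\<close> ext(2)[OF that(1)] ext(1)[OF that(2)]]
        width[OF that(1)] width[OF that(2)] by linarith
  qed
  have "disjoint_family_on J I"
    unfolding disjoint_family_on_def
  proof (intro ballI impI)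
    fix i j assume ij: "i \<in> I" "j \<in> I" "i \<noteq> j"
    then consider "i < j" | "j < i" by linarith
    then show "J i \<inter> J j = {}"
      using sep[OF ij(1,2)] sep[OF ij(2,1)] by cases (auto simp: J_def)
  qed
  then have "card (\<Union>(J ` I)) = (\<Sum>i\<in>I. card (J i))"
    using finI by (intro card_UN_disjoint) (auto simp: disjoint_family_on_def J_def)
  moreover have "card (J i) = 2 * card (L i) + 2" for i
    by (simp add: J_def)
  moreover have "(\<Sum>i\<in>I. 2 * card (L i) + 2) = 2 * (\<Sum>i\<in>I. card (L i)) + 2 * card I"
    by (simp only: sum.distrib sum_distrib_left sum_constant mult.commute of_nat_id)
  ultimately have union: "card (\<Union>(J ` I)) = 2 * (\<Sum>i\<in>I. card (L i)) + 2 * card I"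
    by presburger
  have bounds: "card (L i) + k \<le> 2 * i \<and> 2 * i + card (L i) + k + 2 \<le> 2 * m" if "i \<in> I" for i
  proof -
    have "i < m" using that by (simp add: I_def)
    show ?thesis
      using left[OF \<open>i < m\<close> ext(1)[OF that]] left[OF \<open>i < m\<close> ext(2)[OF that]]
        right[OF \<open>i < m\<close> ext(1)[OF that]] right[OF \<open>i < m\<close> ext(2)[OF that]] width[OF that]
      by linarith
  qed
  have "J i \<subseteq> {int k - 1 ..< 2 * int m - int k - 1}" if "i \<in> I" for i
  proof -
    have "int k - 1 \<le> 2 * int i - int (card (L i)) - 1"
      and "2 * int i + int (card (L i)) + 1 \<le> 2 * int m - int k - 1"
      using bounds[OF that] by linarith+
    then show ?thesis unfolding J_def by (simp add: ivl_subset)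
  qed
  then have "\<Union>(J ` I) \<subseteq> {int k - 1 ..< 2 * int m - int k - 1}" by blast
  then have "card (\<Union>(J ` I)) \<le> card {int k - 1 ..< 2 * int m - int k - 1}"
    by (intro card_mono) auto
  \<comment> \<open>The enclosing interval has \<open>2 * m - 2 * k\<close> elements only if
    \<open>k \<le> m\<close>; otherwise it is empty and its cardinality gives no such
    equation.\<close>
  moreover have "k \<le> m"
  proof -
    obtain i where "i \<in> I" using nonempty by (auto simp: I_def)
    from bounds[OF this] show ?thesis by linarith
  qed
  ultimately have "(\<Sum>i\<in>I. card (L i)) + card I + k \<le> m"
    unfolding union by simp
  moreover have "(\<Sum>i<m. card (L i)) = (\<Sum>i\<in>I. card (L i))"
    by (intro sum.mono_neutral_right) (auto simp: I_def)
  ultimately show ?thesis by (simp add: I_def)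
qed

lemma sum_card_swap:
  assumes "finite A" "finite B"
  shows "(\<Sum>x\<in>A. card {y \<in> B. R x y}) = (\<Sum>y\<in>B. card {x \<in> A. R x y})"
proof -
  have "(\<Sum>x\<in>A. card {y \<in> B. R x y}) = (\<Sum>x\<in>A. \<Sum>y\<in>B. if R x y then 1 else 0)"
    using assms by (simp add: sum.If_cases Int_def)
  also have "\<dots> = (\<Sum>y\<in>B. \<Sum>x\<in>A. if R x y then 1 else 0)"
    by (rule sum.swap)
  also have "\<dots> = (\<Sum>y\<in>B. card {x \<in> A. R x y})"
    using assms by (simp add: sum.If_cases Int_def)
  finally show ?thesis .
qed

section \<open>Paths in a simple graph\<close>

locale simple_graph =
  fixes V :: "'a set" and E :: "'a \<Rightarrow> 'a \<Rightarrow> bool"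
  assumes finV: "finite V"
    and E_sym: "E x y \<Longrightarrow> E y x"
    and E_irrefl: "\<not> E x x"
begin

text \<open>Unlike \<open>vpath\<close>, this admits the empty list, so that every piece of a path
  is a path.\<close>

definition path :: "'a list \<Rightarrow> bool" where
  "path p \<longleftrightarrow> distinct p \<and> successively E p \<and> set p \<subseteq> V"

lemma successively_E_converse: "successively (\<lambda>x y. E y x) p \<longleftrightarrow> successively E p"
  using E_sym by (intro iffI) (auto elim!: successively_mono)

lemma path_rev [simp]: "path (rev p) \<longleftrightarrow> path p"
  by (simp add: path_def successively_E_converse)

lemma path_appendD: "path (p @ q) \<Longrightarrow> path p \<and> path q"
  by (auto simp: path_def successively_append_iff)

text \<open>Pieces of \<open>q\<close> will be inserted into another path and must run from
  \<open>a\<close> to \<open>b\<close> whichever comes first; if \<open>b < a\<close> the piece is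
  reversed. The two conditional lengths express \<open>|a - b| + 1\<close> without truncated
  subtraction.\<close>

lemma path_segment:
  assumes "path q" "a < length q" "b < length q"
  obtains c where "path c" "set c \<subseteq> set q" "c \<noteq> []" "hd c = q ! a" "last c = q ! b"
    "a \<le> b \<Longrightarrow> length c = b - a + 1" "b \<le> a \<Longrightarrow> length c = a - b + 1"
proof -
  have seg: "\<exists>c. path c \<and> set c \<subseteq> set q \<and> c \<noteq> [] \<and> hd c = q ! i \<and> last c = q ! j \<and> length c = j - i + 1"
    if "i \<le> j" "j < length q" for i j
  proof -
    let ?c = "take (j - i + 1) (drop i q)"
    have "path (take i q @ ?c @ drop (j - i + 1) (drop i q))"
      using assms(1) by (simp del: drop_drop)
    then have "path ?c" using path_appendD by blast
    moreover have "set ?c \<subseteq> set q" by (meson order_trans set_drop_subset set_take_subset)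
    moreover have "length ?c = j - i + 1" using that by simp
    moreover from this have "?c \<noteq> []" by force
    moreover have "hd ?c = q ! i" using that by (simp add: hd_drop_conv_nth)
    moreover have "last ?c = q ! j"
    proof -
      have "last ?c = ?c ! (length ?c - 1)" using \<open>?c \<noteq> []\<close> by (rule last_conv_nth)
      also have "\<dots> = q ! j" using that \<open>length ?c = _\<close> by simp
      finally show ?thesis .
    qed
    ultimately show ?thesis by blast
  qed
  show thesis
  proof (cases "a \<le> b")
    case True
    then obtain c where c: "path c" "set c \<subseteq> set q" "c \<noteq> []" "hd c = q ! a" "last c = q ! b"
      "length c = b - a + 1"
      using seg[of a b] assms(3) by auto
    show thesis
      by (rule that[of c]) (use c True in auto)
  next
    case False
    then obtain c where c: "path c" "set c \<subseteq> set q" "c \<noteq> []" "hd c = q ! b" "last c = q ! a"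
      "length c = a - b + 1"
      using seg[of b a] assms(2) by auto
    show thesis
      by (rule that[of "rev c"]) (use c False in \<open>auto simp: hd_rev last_rev\<close>)
  qed
qed

end

section \<open>Exchange arguments on longest paths\<close>

text \<open>The situation of \<open>Pi_graphs\<close> with \<open>m = n - k\<close>. By
  \<open>length_spanning_path\<close> the bound \<open>m\<close> is attained, so it is the detour
  order. \<open>m_ge_2\<close> excludes the edgeless graph on \<open>k + 1\<close> vertices.\<close>

locale spanned_deletions = simple_graph +
  fixes k m :: nat
  assumes k_pos: "k > 0" and m_ge_2: "m \<ge> 2"
    and card_V: "card V = m + k"
    and path_length_le: "path p \<Longrightarrow> length p \<le> m"
    and spanning_path: "S \<subseteq> V \<Longrightarrow> card S = k \<Longrightarrow> \<exists>p. path p \<and> set p = V - S"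
begin

lemma length_spanning_path:
  assumes "path p" "set p = V - S" "S \<subseteq> V" "card S = k"
  shows "length p = m"
proof -
  have "length p = card (V - S)"
    using assms(1,2) by (metis distinct_card path_def)
  also have "\<dots> = m"
    using assms(3,4) card_V finV by (simp add: card_Diff_subset finite_subset)
  finally show ?thesis .
qed

text \<open>Substituting \<open>c\<close> for \<open>p2\<close> gives a path again, which cannot
  have more than \<open>m\<close> vertices. With \<open>p1\<close> or \<open>p3\<close> empty,
  \<open>c\<close> replaces an end of the path.\<close>

lemma length_replacement_le:
  assumes "path (p1 @ p2 @ p3)" "length (p1 @ p2 @ p3) = m"
    and "path c" "c \<noteq> []" "set c \<inter> set (p1 @ p2 @ p3) = {}"
    and "p1 \<noteq> [] \<Longrightarrow> E (last p1) (hd c)" "p3 \<noteq> [] \<Longrightarrow> E (last c) (hd p3)"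
  shows "length c \<le> length p2"
proof -
  have "path (p1 @ c @ p3)"
    using assms unfolding path_def by (auto simp: successively_append_iff)
  from path_length_le[OF this] assms(2) show ?thesis by simp
qed

text \<open>The piece of \<open>q\<close> from \<open>a\<close> to \<open>b\<close> can replace the
  \<open>j - i - 1\<close> vertices strictly between positions \<open>i\<close> and
  \<open>j\<close>. The two inequalities together say
  \<open>|a - b| + 2 \<le> j - i\<close>.\<close>

lemma inner_gap:
  assumes p: "path p" "length p = m" and q: "path q" and disj: "set p \<inter> set q = {}"
    and ij: "i < j" "j < m" and ab: "a < length q" "b < length q"
    and adj: "E (p ! i) (q ! a)" "E (p ! j) (q ! b)"
  shows "i + 2 + a \<le> j + b \<and> i + 2 + b \<le> j + a"
proof -
  obtain c where c: "path c" "set c \<subseteq> set q" "c \<noteq> []" "hd c = q ! a" "last c = q ! b"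
    "a \<le> b \<Longrightarrow> length c = b - a + 1" "b \<le> a \<Longrightarrow> length c = a - b + 1"
    using path_segment[OF q ab] by blast
  let ?p1 = "take (Suc i) p" and ?p2 = "take (j - Suc i) (drop (Suc i) p)" and ?p3 = "drop j p"
  have split: "p = ?p1 @ ?p2 @ ?p3"
  proof -
    have "?p2 @ ?p3 = drop (Suc i) p"
      using ij append_take_drop_id[of "j - Suc i" "drop (Suc i) p"] by simp
    then show ?thesis by simp
  qed
  have "length c \<le> length ?p2"
  proof (rule length_replacement_le)
    show "path (?p1 @ ?p2 @ ?p3)" "length (?p1 @ ?p2 @ ?p3) = m" using p split by simp_all
    show "path c" "c \<noteq> []" using c by auto
    show "set c \<inter> set (?p1 @ ?p2 @ ?p3) = {}" using c(2) disj split by auto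
    show "E (last ?p1) (hd c)" using c adj ij p by (simp add: take_Suc_conv_app_nth)
    show "E (last c) (hd ?p3)" using c adj ij p E_sym by (simp add: hd_drop_conv_nth)
  qed
  moreover have "length ?p2 = j - Suc i" using ij p by simp
  ultimately show ?thesis using c(6,7) ij by (cases "a \<le> b") auto
qed

text \<open>The first \<open>j\<close> vertices of \<open>p\<close> can be replaced by the piece of
  \<open>q\<close> that starts at either end of \<open>q\<close> and stops at \<open>b\<close>;
  these pieces have \<open>b + 1\<close> and \<open>length q - b\<close> vertices.\<close>

lemma initial_gap:
  assumes p: "path p" "length p = m" and q: "path q" and disj: "set p \<inter> set q = {}"
    and "j < m" and b: "b < length q" and adj: "E (p ! j) (q ! b)"
  shows "b + 1 \<le> j \<and> length q \<le> j + b"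
proof -
  have gap: "length c \<le> j" if c: "path c" "set c \<subseteq> set q" "c \<noteq> []" "last c = q ! b" for c
  proof -
    have "length c \<le> length (take j p)"
      by (rule length_replacement_le[of "[]" _ "drop j p"])
        (use that p disj adj \<open>j < m\<close> E_sym in \<open>auto simp: hd_drop_conv_nth\<close>)
    then show ?thesis using p \<open>j < m\<close> by simp
  qed
  have "0 < length q" "length q - 1 < length q" using b by auto
  obtain c where "path c" "set c \<subseteq> set q" "c \<noteq> []" "last c = q ! b" "length c = b + 1"
    using path_segment[OF q \<open>0 < length q\<close> b] by (metis diff_zero le0)
  moreover obtain d where "path d" "set d \<subseteq> set q" "d \<noteq> []" "last d = q ! b"
    "length d = length q - 1 - b + 1"
    using path_segment[OF q \<open>length q - 1 < length q\<close> b] b by (metis Suc_pred' \<open>0 < length q\<close> less_Suc_eq_le)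
  ultimately show ?thesis using gap[of c] gap[of d] b by linarith
qed

lemma final_gap:
  assumes p: "path p" "length p = m" and q: "path q" and disj: "set p \<inter> set q = {}"
    and "j < m" and b: "b < length q" and adj: "E (p ! j) (q ! b)"
  shows "j + b + 2 \<le> m \<and> length q + j + 1 \<le> m + b"
proof -
  have "rev p ! (m - 1 - j) = p ! j" using p \<open>j < m\<close> by (simp add: rev_nth)
  then have "b + 1 \<le> m - 1 - j \<and> length q \<le> m - 1 - j + b"
    by (intro initial_gap[of "rev p"]) (use assms in auto)
  then show ?thesis using \<open>j < m\<close> by linarith
qed

section \<open>Minimum degree and induced paths\<close>

lemma path_neighbour:
  assumes "path p" "length p = m" "v \<in> set p"
  obtains i j where "i < m" "j < m" "p ! i = v" "E v (p ! j)" "j = i + 1 \<or> i = j + 1"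
proof -
  obtain i where i: "i < m" "p ! i = v" using assms by (metis in_set_conv_nth)
  show thesis
  proof (cases "i + 1 < m")
    case True
    then have "E (p ! i) (p ! Suc i)" using assms by (auto simp: path_def intro: successively_nth)
    then show thesis using that[of i "i + 1"] i True by simp
  next
    case False
    then have "Suc (i - 1) = i" using m_ge_2 by simp
    then have "E (p ! (i - 1)) (p ! i)"
      using assms i by (metis path_def successively_nth)
    then show thesis using that[of i "i - 1"] i \<open>Suc (i - 1) = i\<close> E_sym by simp
  qed
qed

(* If x has at most k + 1 neighbours, delete k vertices so that at most one neighbour of x survives:
   then x ends a longest path although one of its neighbours was deleted. *)
lemma degree_ge:
  assumes "x \<in> V"
  shows "k + 2 \<le> card {y \<in> V. E x y}"
proof (rule ccontr)
  let ?N = "{y \<in> V. E x y}"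
  assume "\<not> ?thesis"
  then have deg: "card ?N \<le> k + 1" by simp
  have finN: "finite ?N" using finV by simp
  have NV: "?N \<subseteq> V - {x}" using E_irrefl by auto
  have cVx: "k \<le> card (V - {x})" using assms card_V m_ge_2 by (simp add: finV)
  show False
  proof (cases "card ?N \<le> k")
    case True
    \<comment> \<open>With all its neighbours deleted, \<open>x\<close> would be isolated on a path
      with at least two vertices.\<close>
    obtain S where S: "?N \<subseteq> S" "S \<subseteq> V - {x}" "card S = k"
      using exists_subset_between[OF True cVx NV] finV by auto
    then obtain p where p: "path p" "set p = V - S" using spanning_path by blast
    have len: "length p = m" using length_spanning_path p S by blast
    have "x \<in> set p" using p S assms by auto
    then obtain j where "j < m" "E x (p ! j)" using path_neighbour[OF p(1) len] by metis
    moreover have "p ! j \<in> V - S" using p len \<open>j < m\<close> nth_mem by blast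
    ultimately show False using S by auto
  next
    case False
    then have cN: "card ?N = k + 1" using deg by simp
    then have "?N \<noteq> {}" by (metis add_is_0 card.empty one_neq_zero)
    then obtain y where y: "y \<in> ?N" by blast
    define S where "S = ?N - {y}"
    have S: "S \<subseteq> V" "card S = k" using y cN finN by (auto simp: S_def)
    obtain p where p: "path p" "set p = V - S" using spanning_path[OF S] by blast
    have len: "length p = m" using length_spanning_path p S by blast
    have "x \<in> set p" using p assms E_irrefl by (auto simp: S_def)
    then obtain i where i: "i < m" "p ! i = x" using len by (metis in_set_conv_nth)
    obtain s where s: "s \<in> S" using S k_pos by fastforce
    \<comment> \<open>The gap lemmas for the one-vertex path \<open>[s]\<close> show that
      \<open>x\<close> is an inner vertex of \<open>p\<close>. But \<open>y\<close> is its only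
      surviving neighbour, so it would have to stand on both sides of \<open>x\<close>.\<close>
    have sing: "path [s]" using s S by (auto simp: path_def)
    have disj: "set p \<inter> set [s] = {}" using p s by auto
    have adj: "E (p ! i) ([s] ! 0)" using s i by (simp add: S_def)
    have "1 \<le> i"
      using initial_gap[OF p(1) len sing disj i(1) _ adj] by simp
    moreover have "i + 2 \<le> m"
      using final_gap[OF p(1) len sing disj i(1) _ adj] by simp
    ultimately have nbr: "E (p ! i) (p ! (i - 1))" "E (p ! i) (p ! (i + 1))"
      using p(1) len successively_nth[of E p "i - 1"] successively_nth[of E p i] E_sym
      by (auto simp: path_def)
    have only: "p ! j = y" if "j < m" "E (p ! i) (p ! j)" for j
    proof -
      have "p ! j \<in> V - S" using p len that nth_mem by blast
      then show ?thesis using that i by (auto simp: S_def)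
    qed
    have "p ! (i - 1) = p ! (i + 1)"
      using only[of "i - 1"] only[of "i + 1"] nbr \<open>i + 2 \<le> m\<close> by simp
    then show False
      using p(1) len \<open>i + 2 \<le> m\<close> by (simp add: path_def nth_eq_iff_index_eq)
  qed
qed

(* To prolong an induced path v # c, delete k vertices including c but not v: a neighbour of v on the
   spanning path of the rest is not adjacent to c, as otherwise part of c could be inserted. *)
lemma induced_path_exists:
  assumes "1 \<le> j" "j \<le> k"
  shows "\<exists>q. path q \<and> length q = j \<and> (\<forall>a<j. \<forall>b<j. E (q ! a) (q ! b) \<longrightarrow> a = b + 1 \<or> b = a + 1)"
  using assms
proof (induction j rule: dec_induct)
  case base
  obtain v where "v \<in> V" using card_V m_ge_2 by fastforce
  then have "path [v]" by (simp add: path_def)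
  then show ?case using E_irrefl by (intro exI[of _ "[v]"]) auto
next
  case (step j)
  then obtain q where q: "path q" "length q = j"
    and ind: "\<And>a b. a < j \<Longrightarrow> b < j \<Longrightarrow> E (q ! a) (q ! b) \<Longrightarrow> a = b + 1 \<or> b = a + 1"
    by auto
  obtain v c where vc: "q = v # c" using q step by (cases q) auto
  have c: "path c" "v \<notin> set c" "v \<in> V" "set c \<subseteq> V" "c \<noteq> [] \<Longrightarrow> E v (c ! 0)"
    using q(1) by (auto simp: vc path_def successively_Cons hd_conv_nth)
  have "card (set c) \<le> k"
    using card_length[of c] q step vc by simp
  moreover have "k \<le> card (V - {v})" using c card_V m_ge_2 by (simp add: finV)
  ultimately obtain S where S: "set c \<subseteq> S" "S \<subseteq> V - {v}" "card S = k"
    using exists_subset_between[of "set c" k "V - {v}"] c finV by auto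
  then obtain p where p: "path p" "set p = V - S" using spanning_path by blast
  have len: "length p = m" using length_spanning_path p S by blast
  have "v \<in> set p" using p S c by auto
  then obtain i i' where i: "i < m" "i' < m" "p ! i = v" "E v (p ! i')" "i' = i + 1 \<or> i = i' + 1"
    using path_neighbour[OF p(1) len] by metis
  define w where "w = p ! i'"
  have "w \<in> V - S" using p len i nth_mem w_def by blast
  then have w: "w \<in> V" "w \<notin> set c" "w \<noteq> v" using S i(4) E_irrefl by (auto simp: w_def)
  have disj: "set p \<inter> set c = {}" using p S by auto
  \<comment> \<open>\<open>v\<close> and \<open>w\<close> are consecutive on \<open>p\<close>, so
    there is no vertex between them to give up for the piece of \<open>c\<close> from
    \<open>c ! 0\<close> to \<open>c ! a\<close>.\<close>
  have far: "\<not> E w (c ! a)" if "a < length c" for a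
  proof
    assume "E w (c ! a)"
    then have adj: "E (p ! i') (c ! a)" by (simp add: w_def)
    have "0 < length c" using that by linarith
    then have adj0: "E (p ! i) (c ! 0)" using c(5) i by auto
    from i(5) show False
    proof
      assume "i' = i + 1"
      then show False
        using inner_gap[OF p(1) len c(1) disj _ i(2) \<open>0 < length c\<close> that adj0 adj] by simp
    next
      assume "i = i' + 1"
      then show False
        using inner_gap[OF p(1) len c(1) disj _ i(1) that \<open>0 < length c\<close> adj adj0] by simp
    qed
  qed
  have "path (w # q)"
    using q(1) w i(4) E_sym by (auto simp: path_def vc w_def)
  moreover have "a = b + 1 \<or> b = a + 1"
    if "a < Suc j" "b < Suc j" "E ((w # q) ! a) ((w # q) ! b)" for a b
  proof -
    have first: "d = 1" if "d < Suc j" "E w ((w # q) ! d)" for d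
    proof (rule ccontr)
      assume "d \<noteq> 1"
      moreover have "d \<noteq> 0" using that E_irrefl by (intro notI) auto
      ultimately obtain e where "d = Suc (Suc e)" by (metis One_nat_def not0_implies_Suc)
      then show False using far[of e] that q vc by simp
    qed
    show ?thesis
    proof (cases a)
      case 0
      then show ?thesis using first[of b] that by simp
    next
      case a: (Suc a')
      show ?thesis
      proof (cases b)
        case 0
        then show ?thesis using first[of a] that E_sym by simp
      next
        case (Suc b')
        then show ?thesis using ind[of a' b'] that a by simp
      qed
    qed
  qed
  ultimately show ?case using q(2) by (intro exI[of _ "w # q"]) auto
qed

section \<open>The lower bound on the detour order\<close>

text \<open>The summands match those of \<open>sum_card_labels_le\<close>: \<open>k\<close> for the
  two ends, \<open>k + 1\<close> for the positions with a label (the neighbours of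
  \<open>q ! 0\<close> alone supply them), and \<open>k * k\<close> for the edges between
  \<open>q\<close> and \<open>p\<close>.\<close>

lemma m_ge: "k + (k + 1) + k * k \<le> m"
proof -
  obtain q where q: "path q" "length q = k"
    and ind: "\<And>a b. a < k \<Longrightarrow> b < k \<Longrightarrow> E (q ! a) (q ! b) \<Longrightarrow> a = b + 1 \<or> b = a + 1"
    using induced_path_exists[of k] k_pos by auto
  have S: "set q \<subseteq> V" "card (set q) = k"
    using q by (auto simp: path_def distinct_card)
  obtain p where p: "path p" "set p = V - set q" using spanning_path[OF S] by blast
  have len: "length p = m" using length_spanning_path p S by blast
  have disj: "set p \<inter> set q = {}" using p by auto
  define L where "L i = {a \<in> {..<k}. E (p ! i) (q ! a)}" for i
  have count: "card {i \<in> {..<m}. E (p ! i) (q ! a)} = card ({y \<in> V. E (q ! a) y} - set q)" for a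
  proof -
    have "(!) p ` {i \<in> {..<m}. E (p ! i) (q ! a)} = {y \<in> V. E (q ! a) y} - set q"
    proof
      show "(!) p ` {i \<in> {..<m}. E (p ! i) (q ! a)} \<subseteq> {y \<in> V. E (q ! a) y} - set q"
        using p(2) len E_sym nth_mem[of _ p] by auto
      show "{y \<in> V. E (q ! a) y} - set q \<subseteq> (!) p ` {i \<in> {..<m}. E (p ! i) (q ! a)}"
      proof
        fix y assume y: "y \<in> {y \<in> V. E (q ! a) y} - set q"
        then have "y \<in> set p" using p(2) by auto
        then obtain i where "i < m" "p ! i = y" using len by (metis in_set_conv_nth)
        then show "y \<in> (!) p ` {i \<in> {..<m}. E (p ! i) (q ! a)}" using y E_sym by auto
      qed
    qed
    moreover have "inj_on ((!) p) {i \<in> {..<m}. E (p ! i) (q ! a)}"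
      using p(1) len by (auto simp: path_def inj_on_def nth_eq_iff_index_eq)
    ultimately show ?thesis using card_image by metis
  qed
  \<comment> \<open>\<open>T\<close> collects the indices at which \<open>q ! a\<close> may have
    neighbours on \<open>q\<close>; the other neighbours lie on \<open>p\<close>.\<close>
  have outer: "k + 2 \<le> card ({y \<in> V. E (q ! a) y} - set q) + card T"
    if "a < k" "\<And>b. b < k \<Longrightarrow> E (q ! a) (q ! b) \<Longrightarrow> b \<in> T" "finite T" for a T
  proof -
    let ?N = "{y \<in> V. E (q ! a) y}"
    have "q ! a \<in> V" using that q S by auto
    have finN: "finite ?N" using finV by simp
    have "?N \<inter> set q \<subseteq> (!) q ` T"
      using that(2) q by (auto simp: in_set_conv_nth)
    then have "card (?N \<inter> set q) \<le> card ((!) q ` T)" using that(3) by (intro card_mono) auto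
    also have "\<dots> \<le> card T" using that(3) by (rule card_image_le)
    finally show ?thesis
      using degree_ge[OF \<open>q ! a \<in> V\<close>] card_Int_Diff[OF finN, of "set q"] by linarith
  qed
  have degree: "k \<le> card {i \<in> {..<m}. E (p ! i) (q ! a)}" if "a < k" for a
  proof -
    \<comment> \<open>For \<open>a = 0\<close> the truncated \<open>a - 1\<close> is
      \<open>0\<close>, which is harmless: the set only has to contain the indices of the neighbours
      and have at most two elements.\<close>
    have "b \<in> {a - 1, a + 1}" if "b < k" "E (q ! a) (q ! b)" for b
      using ind[OF \<open>a < k\<close> that] by auto
    then have "k + 2 \<le> card ({y \<in> V. E (q ! a) y} - set q) + card {a - 1, a + 1}"
      by (intro outer[OF that]) auto
    moreover have "card {a - 1, a + 1} \<le> 2" by (simp add: card_insert_if)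
    ultimately show ?thesis unfolding count by linarith
  qed
  \<comment> \<open>An end of the induced path has at most one neighbour on it, so one more than
    \<open>k\<close> of its neighbours lie outside.\<close>
  have degree0: "k + 1 \<le> card {i \<in> {..<m}. E (p ! i) (q ! 0)}"
  proof -
    have "b \<in> {1}" if "b < k" "E (q ! 0) (q ! b)" for b
      using ind[OF k_pos that] by auto
    then have "k + 2 \<le> card ({y \<in> V. E (q ! 0) y} - set q) + card {1::nat}"
      by (intro outer[OF k_pos]) auto
    then show ?thesis unfolding count by simp
  qed
  have "{i \<in> {..<m}. E (p ! i) (q ! 0)} \<subseteq> {i. i < m \<and> L i \<noteq> {}}"
    using k_pos by (auto simp: L_def)
  then have "card {i \<in> {..<m}. E (p ! i) (q ! 0)} \<le> card {i. i < m \<and> L i \<noteq> {}}"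
    by (intro card_mono) auto
  with degree0 have support: "k + 1 \<le> card {i. i < m \<and> L i \<noteq> {}}" by linarith
  have "k * k = (\<Sum>a<k. k)" by simp
  also have "\<dots> \<le> (\<Sum>a<k. card {i \<in> {..<m}. E (p ! i) (q ! a)})"
    by (intro sum_mono) (use degree in auto)
  also have "\<dots> = (\<Sum>i<m. card (L i))"
    unfolding L_def by (rule sum_card_swap[symmetric]) auto
  finally have labels: "k * k \<le> (\<Sum>i<m. card (L i))" .
  have "k + card {i. i < m \<and> L i \<noteq> {}} + (\<Sum>i<m. card (L i)) \<le> m"
  proof (rule sum_card_labels_le)
    show "L i \<subseteq> {..<k}" for i by (auto simp: L_def)
    show "i + 2 + a \<le> j + b \<and> i + 2 + b \<le> j + a"
      if "i < j" "j < m" "a \<in> L i" "b \<in> L j" for i j a b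
      using inner_gap[OF p(1) len q(1) disj that(1,2)] that(3,4) q(2) by (simp add: L_def)
    show "a + 1 \<le> i \<and> k \<le> i + a" if "i < m" "a \<in> L i" for i a
      using initial_gap[OF p(1) len q(1) disj that(1)] that(2) q(2) by (simp add: L_def)
    show "i + a + 2 \<le> m \<and> k + i + 1 \<le> m + a" if "i < m" "a \<in> L i" for i a
      using final_gap[OF p(1) len q(1) disj that(1)] that(2) q(2) by (simp add: L_def)
    have "{i. i < m \<and> L i \<noteq> {}} \<noteq> {}" using support by (intro notI) simp
    then show "\<exists>i<m. L i \<noteq> {}" by blast
  qed
  then show ?thesis using support labels by linarith
qed

end

section \<open>Transfer to pair digraphs\<close>

lemma set_vwalk_arcs_subset_iff:
  "set (vwalk_arcs p) \<subseteq> R \<longleftrightarrow> successively (\<lambda>x y. (x, y) \<in> R) p"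
  by (induction p rule: vwalk_arcs.induct) auto

lemma vpath_iff_successively:
  "vpath p G \<longleftrightarrow> p \<noteq> [] \<and> distinct p \<and> set p \<subseteq> verts G \<and> successively (\<lambda>x y. (x, y) \<in> arcs_ends G) p"
  by (auto simp: vpath_def vwalk_def set_vwalk_arcs_subset_iff)

lemma length_le_detour_order:
  assumes "finite (verts G)" "vpath p G"
  shows "length p \<le> detour_order G"
proof -
  have "length q \<le> card (verts G)" if "vpath q G" for q
    using that assms(1) by (metis card_mono distinct_card vpath_iff_successively)
  then have "{length p |p. vpath p G} \<subseteq> {..card (verts G)}" by auto
  then have "finite {length p |p. vpath p G}" by (rule finite_subset) simp
  then show ?thesis unfolding detour_order_def using assms(2) by (intro Max_ge) auto
qed

theorem theorem1p5:
  fixes n k :: nat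
  assumes "n > 0" and "k > 0"
    and "n \<noteq> k + 1"
    and "n < k^2 + 2 * k + 2"
  shows "(Pi_graphs n k :: 'a pair_pre_digraph set) = {}"
proof (rule ccontr)
  assume "\<not> ?thesis"
  then obtain G :: "'a pair_pre_digraph" where "G \<in> Pi_graphs n k" by blast
  then have G: "pair_graph G" "card (pverts G) = n" "detour_order (with_proj G) + k = n"
    and ham: "\<And>S. S \<subseteq> pverts G \<Longrightarrow> card S = k \<Longrightarrow>
      \<exists>p. hamilton_path p (with_proj G \<restriction> (pverts G - S))"
    by (auto simp: Pi_graphs_def)
  interpret pair_graph G by (rule G)
  define m where "m = detour_order (with_proj G)"
  interpret simple_graph "pverts G" "\<lambda>x y. (x, y) \<in> parcs G"
  proof
    show "(y, x) \<in> parcs G" if "(x, y) \<in> parcs G" for x y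
      using that sym_arcs by (auto simp: symmetric_def sym_def)
    show "(x, x) \<notin> parcs G" for x using no_loops[of "(x, x)"] by auto
  qed simp
  have short: "length p \<le> m" if "path p" for p
    using that length_le_detour_order[of "with_proj G" p]
    by (cases "p = []") (auto simp: m_def path_def vpath_iff_successively)
  have "pverts G \<noteq> {}" using G(2) assms(1) by auto
  then obtain v where "v \<in> pverts G" by blast
  then have "1 \<le> m" using short[of "[v]"] by (simp add: path_def)
  \<comment> \<open>\<open>m = 1\<close> would mean \<open>n = k + 1\<close>, the case of the
    edgeless graphs.\<close>
  then have "2 \<le> m" using G(3) assms(3) by (simp add: m_def)
  have spanning: "\<exists>p. path p \<and> set p = pverts G - S" if S: "S \<subseteq> pverts G" "card S = k" for S
  proof -
    obtain p where p: "hamilton_path p (with_proj G \<restriction> (pverts G - S))" using ham[OF S] by blast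
    have "arcs_ends (with_proj G \<restriction> (pverts G - S)) \<subseteq> parcs G"
      by (auto simp: arcs_ends_def arc_to_ends_def)
    then have "path p"
      using p by (auto simp: hamilton_path_def vpath_iff_successively path_def elim!: successively_mono)
    then show ?thesis using p by (auto simp: hamilton_path_def)
  qed
  interpret spanned_deletions "pverts G" "\<lambda>x y. (x, y) \<in> parcs G" k m
    by unfold_locales (use assms(2) \<open>2 \<le> m\<close> short spanning G m_def in auto)
  have "k + (k + 1) + k * k \<le> m" by (rule m_ge)
  \<comment> \<open>\<open>n = m + k\<close> is at least \<open>k^2 + 3 * k + 1\<close>, and this is
    at least \<open>k^2 + 2 * k + 2\<close> because \<open>k \<ge> 1\<close>.\<close>
  then show False using assms(2,4) G(3) by (simp add: m_def power2_eq_square)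
qed

end
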